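(* The vertex-Turán density of $Q_7$ is greater than $7/8$. Equivalently, $\gamma_7 < 1/8$.
   Context: Let $Q_n$ denote the $n$-dimensional discrete cube with vertex set $\{0,1\}^n$, two vectors being adjacent if they differ in exactly one coordinate. A copy of $Q_d$ in $Q_n$ is the vertex set of a $d$-dimensional subcube, i.e. a set of the form $\{x \in \{0,1\}^n : x_i = a_i \text{ for all } i \notin I\}$ for some $I \subset [n]$ with $|I| = d$ and some fixed values $a_i \in \{0,1\}$. Let $\mathrm{exc}(n,Q_d)$ be the maximum size of a subset of $\{0,1\}^n$ containing no copy of $Q_d$, and define the vertex-Turán density $\lambda(Q_d) = \lim_{n\to\infty} \mathrm{exc}(n,Q_d)/2^n$ (this limit exists). Let $g(n,d)$ be the minimum size of a subset of $\{0,1\}^n$ that intersects every copy of $Q_d$, and $\gamma_d = \lim_{n\to\infty} g(n,d)/2^n$, so that $\gamma_d = 1 - \lambda(Q_d)$. *)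

theory Defs
  imports Complex_Main "HOL-Library.FuncSet"
begin

definition cube :: "nat \<Rightarrow> (nat \<Rightarrow> nat) set" where
  "cube n = {1..n} \<rightarrow>\<^sub>E {0, 1}"

definition is_subcube :: "nat \<Rightarrow> nat \<Rightarrow> (nat \<Rightarrow> nat) set \<Rightarrow> bool" where
  "is_subcube n d S \<longleftrightarrow>
     (\<exists>I a. I \<subseteq> {1..n} \<and> card I = d \<and> a \<in> ({1..n} - I) \<rightarrow> {0, 1} \<and>
        S = {x \<in> cube n. \<forall>i \<in> {1..n} - I. x i = a i})"

definition subcube_free :: "nat \<Rightarrow> nat \<Rightarrow> (nat \<Rightarrow> nat) set \<Rightarrow> bool" where
  "subcube_free n d A \<longleftrightarrow> \<not> (\<exists>S. is_subcube n d S \<and> S \<subseteq> A)"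

definition subcube_hitting :: "nat \<Rightarrow> nat \<Rightarrow> (nat \<Rightarrow> nat) set \<Rightarrow> bool" where
  "subcube_hitting n d A \<longleftrightarrow> (\<forall>S. is_subcube n d S \<longrightarrow> A \<inter> S \<noteq> {})"

definition exc :: "nat \<Rightarrow> nat \<Rightarrow> nat" where
  "exc n d = Max {card A | A. A \<subseteq> cube n \<and> subcube_free n d A}"

definition min_hitting :: "nat \<Rightarrow> nat \<Rightarrow> nat" where
  "min_hitting n d = Min {card A | A. A \<subseteq> cube n \<and> subcube_hitting n d A}"

definition vertex_turan_density :: "nat \<Rightarrow> real" where
  "vertex_turan_density d = lim (\<lambda>n. real (exc n d) / 2 ^ n)"

definition hitting_density :: "nat \<Rightarrow> real" where
  "hitting_density d = lim (\<lambda>n. real (min_hitting n d) / 2 ^ n)"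

text \<open>The maximum, the minimum and both limits above are well defined, and the
  two densities add up to one.\<close>

lemma finite_cube: "finite (cube n)"
  by (simp add: cube_def finite_PiE)

lemma card_cube: "card (cube n) = 2 ^ n"
  by (simp add: cube_def card_PiE numeral_2_eq_2)

lemma is_subcube_subset: "is_subcube n d S \<Longrightarrow> S \<subseteq> cube n"
  by (auto simp: is_subcube_def)

lemma is_subcube_nonempty:
  assumes "is_subcube n d S"
  shows "S \<noteq> {}"
proof -
  obtain I a where "a \<in> ({1..n} - I) \<rightarrow> {0, 1}"
    and S: "S = {x \<in> cube n. \<forall>i \<in> {1..n} - I. x i = a i}"
    using assms by (auto simp: is_subcube_def)
  then have "restrict (\<lambda>i. if i \<in> I then 0 else a i) {1..n} \<in> S"
    by (auto simp: cube_def Pi_iff)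
  then show ?thesis by blast
qed

lemma finite_free_cards: "finite {card A | A. A \<subseteq> cube n \<and> subcube_free n d A}"
  by (rule finite_subset[of _ "card ` Pow (cube n)"]) (auto simp: finite_cube)

lemma finite_hitting_cards: "finite {card A | A. A \<subseteq> cube n \<and> subcube_hitting n d A}"
  by (rule finite_subset[of _ "card ` Pow (cube n)"]) (auto simp: finite_cube)

lemma subcube_free_empty: "subcube_free n d {}"
  using is_subcube_nonempty by (auto simp: subcube_free_def)

lemma card_le_exc: "A \<subseteq> cube n \<Longrightarrow> subcube_free n d A \<Longrightarrow> card A \<le> exc n d"
  unfolding exc_def by (rule Max_ge[OF finite_free_cards]) auto

lemma exc_attained:
  obtains A where "A \<subseteq> cube n" "subcube_free n d A" "card A = exc n d"
proof -
  have "{card A | A. A \<subseteq> cube n \<and> subcube_free n d A} \<noteq> {}"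
    using subcube_free_empty by blast
  from Max_in[OF finite_free_cards this] show ?thesis
    using that by (auto simp: exc_def)
qed

lemma subcube_hitting_cube: "subcube_hitting n d (cube n)"
  using is_subcube_nonempty is_subcube_subset unfolding subcube_hitting_def by blast

lemma g_le_card: "A \<subseteq> cube n \<Longrightarrow> subcube_hitting n d A \<Longrightarrow> min_hitting n d \<le> card A"
  unfolding min_hitting_def by (rule Min_le[OF finite_hitting_cards]) auto

lemma g_attained:
  obtains A where "A \<subseteq> cube n" "subcube_hitting n d A" "card A = min_hitting n d"
proof -
  have "{card A | A. A \<subseteq> cube n \<and> subcube_hitting n d A} \<noteq> {}"
    using subcube_hitting_cube by blast
  from Min_in[OF finite_hitting_cards this] show ?thesis
    using that by (auto simp: min_hitting_def)
qed

lemma subcube_hitting_complement: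
  assumes "A \<subseteq> cube n"
  shows "subcube_hitting n d (cube n - A) \<longleftrightarrow> subcube_free n d A"
  using is_subcube_subset unfolding subcube_hitting_def subcube_free_def by blast

lemma exc_plus_g: "exc n d + min_hitting n d = 2 ^ n"
proof (rule antisym)
  obtain A where A: "A \<subseteq> cube n" "subcube_free n d A" "card A = exc n d"
    by (rule exc_attained)
  have "min_hitting n d \<le> card (cube n - A)"
    using A subcube_hitting_complement by (intro g_le_card) auto
  moreover have "card (cube n - A) + card A = 2 ^ n"
    using A(1) finite_cube[of n] card_cube[of n]
    by (metis card_Diff_subset card_mono finite_subset le_add_diff_inverse2)
  ultimately show "exc n d + min_hitting n d \<le> 2 ^ n" using A(3) by linarith
next
  obtain B where B: "B \<subseteq> cube n" "subcube_hitting n d B" "card B = min_hitting n d"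
    by (rule g_attained)
  have "cube n - (cube n - B) = B" using B(1) by blast
  then have "card (cube n - B) \<le> exc n d"
    using B subcube_hitting_complement[of "cube n - B" n d] by (intro card_le_exc) auto
  moreover have "card (cube n - B) + card B = 2 ^ n"
    using B(1) finite_cube[of n] card_cube[of n]
    by (metis card_Diff_subset card_mono finite_subset le_add_diff_inverse2)
  ultimately show "2 ^ n \<le> exc n d + min_hitting n d" using B(3) by linarith
qed

lemma cube_Suc_upd: "x \<in> cube n \<Longrightarrow> b \<in> {0, 1} \<Longrightarrow> x(Suc n := b) \<in> cube (Suc n)"
  by (auto simp: cube_def PiE_iff extensional_def)

lemma cube_Suc_restrict: "x \<in> cube (Suc n) \<Longrightarrow> x(Suc n := undefined) \<in> cube n"
  by (auto simp: cube_def PiE_iff extensional_def)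

lemma slice_subcube_free:
  assumes free: "subcube_free (Suc n) d A" and b: "b \<in> {0, 1}"
  shows "subcube_free n d {x \<in> cube n. x(Suc n := b) \<in> A}"
  unfolding subcube_free_def
proof
  assume "\<exists>S. is_subcube n d S \<and> S \<subseteq> {x \<in> cube n. x(Suc n := b) \<in> A}"
  then obtain I a where I: "I \<subseteq> {1..n}" "card I = d" and a: "a \<in> ({1..n} - I) \<rightarrow> {0, 1}"
    and sub: "{x \<in> cube n. \<forall>i \<in> {1..n} - I. x i = a i} \<subseteq> {x \<in> cube n. x(Suc n := b) \<in> A}"
    by (auto simp: is_subcube_def)
  define a' where "a' = a(Suc n := b)"
  define S where "S = {x \<in> cube (Suc n). \<forall>i \<in> {1..Suc n} - I. x i = a' i}"
  have "is_subcube (Suc n) d S"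
    unfolding is_subcube_def
    by (rule exI[of _ I], rule exI[of _ a'])
      (use I a b in \<open>auto simp: S_def a'_def Pi_iff\<close>)
  moreover have "S \<subseteq> A"
  proof
    fix x assume "x \<in> S"
    then have x: "x \<in> cube (Suc n)" and eq: "\<And>i. i \<in> {1..Suc n} - I \<Longrightarrow> x i = a' i"
      by (auto simp: S_def)
    have "x i = a i" if "i \<in> {1..n} - I" for i
      using eq[of i] that by (auto simp: a'_def)
    then have "x(Suc n := undefined) \<in> {x \<in> cube n. \<forall>i \<in> {1..n} - I. x i = a i}"
      using cube_Suc_restrict[OF x] by auto
    then have "(x(Suc n := undefined))(Suc n := b) \<in> A" using sub by blast
    moreover have "x (Suc n) = b" using eq[of "Suc n"] I(1) by (force simp: a'_def)
    ultimately show "x \<in> A" by auto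
  qed
  ultimately show False using free by (auto simp: subcube_free_def)
qed

lemma exc_Suc: "exc (Suc n) d \<le> 2 * exc n d"
proof -
  obtain A where A: "A \<subseteq> cube (Suc n)" "subcube_free (Suc n) d A" "card A = exc (Suc n) d"
    by (rule exc_attained)
  define L where "L b = {x \<in> cube n. x(Suc n := b) \<in> A}" for b
  have fin: "finite (L b)" for b by (simp add: L_def finite_cube)
  have le: "card (L b) \<le> exc n d" if "b \<in> {0, 1}" for b
    unfolding L_def using slice_subcube_free[OF A(2) that] by (intro card_le_exc) auto
  have "A \<subseteq> (\<lambda>x. x(Suc n := 0)) ` L 0 \<union> (\<lambda>x. x(Suc n := 1)) ` L 1"
  proof
    fix x assume x: "x \<in> A"
    then have xc: "x \<in> cube (Suc n)" using A(1) by blast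
    then have "x (Suc n) \<in> {0, 1}" by (auto simp: cube_def PiE_iff)
    moreover have "x = (x(Suc n := undefined))(Suc n := x (Suc n))" by simp
    moreover have "x(Suc n := undefined) \<in> L (x (Suc n))"
      using x cube_Suc_restrict[OF xc] by (simp add: L_def)
    ultimately show "x \<in> (\<lambda>x. x(Suc n := 0)) ` L 0 \<union> (\<lambda>x. x(Suc n := 1)) ` L 1"
      by (metis UnCI image_eqI insertE singletonD)
  qed
  then have "card A \<le> card ((\<lambda>x. x(Suc n := 0)) ` L 0 \<union> (\<lambda>x. x(Suc n := 1)) ` L 1)"
    by (intro card_mono) (auto simp: fin)
  also have "\<dots> \<le> card ((\<lambda>x. x(Suc n := 0)) ` L 0) + card ((\<lambda>x. x(Suc n := 1)) ` L 1)"
    by (rule card_Un_le)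
  also have "\<dots> \<le> card (L 0) + card (L 1)"
    by (intro add_mono card_image_le fin)
  also have "\<dots> \<le> 2 * exc n d" using le[of 0] le[of 1] by simp
  finally show ?thesis using A(3) by simp
qed

lemma convergent_exc: "convergent (\<lambda>n. real (exc n d) / 2 ^ n)"
proof (rule Bseq_monoseq_convergent)
  have dec: "decseq (\<lambda>n. real (exc n d) / 2 ^ n)"
  proof (rule decseq_SucI)
    fix n
    have "real (exc (Suc n) d) \<le> 2 * real (exc n d)" using exc_Suc[of n d] by linarith
    then show "real (exc (Suc n) d) / 2 ^ Suc n \<le> real (exc n d) / 2 ^ n"
      by (simp add: field_simps)
  qed
  then show "monoseq (\<lambda>n. real (exc n d) / 2 ^ n)" by (rule decseq_imp_monoseq)
  have "exc n d \<le> 2 ^ n" for n using exc_plus_g[of n d] by linarith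
  then have "real (exc n d) \<le> 2 ^ n" for n
    by (metis of_nat_le_iff of_nat_numeral of_nat_power)
  then show "Bseq (\<lambda>n. real (exc n d) / 2 ^ n)"
    by (intro BseqI'[of _ 1]) (simp add: field_simps)
qed

lemma g_density_eq: "real (min_hitting n d) / 2 ^ n = 1 - real (exc n d) / 2 ^ n"
proof -
  have "real (exc n d) + real (min_hitting n d) = 2 ^ n"
    using exc_plus_g[of n d] by (metis of_nat_add of_nat_numeral of_nat_power)
  then show ?thesis by (simp add: field_simps)
qed

lemma LIMSEQ_exc: "(\<lambda>n. real (exc n d) / 2 ^ n) \<longlonglongrightarrow> vertex_turan_density d"
  unfolding vertex_turan_density_def using convergent_exc convergent_LIMSEQ_iff by blast

lemma LIMSEQ_g: "(\<lambda>n. real (min_hitting n d) / 2 ^ n) \<longlonglongrightarrow> 1 - vertex_turan_density d"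
  unfolding g_density_eq by (intro tendsto_intros LIMSEQ_exc)

lemma hitting_density_eq: "hitting_density d = 1 - vertex_turan_density d"
  unfolding hitting_density_def using LIMSEQ_g by (rule limI)

end

theory Submission
  imports Defs "HOL-Library.Function_Algebras" "Berlekamp_Zassenhaus.Finite_Field"
begin

text \<open>For each \<open>r\<close> assign to the elements of \<open>{1..n}\<close> vectors of \<open>F\<^sub>3\<^sup>r\<close>. Identify points of the cube
  with subsets of \<open>{1..n}\<close> and let the hitting set consist of the sets \<open>A\<close> with \<open>|A|\<close> in a fixed
  residue class mod 4 whose vectors are not a basis of \<open>F\<^sub>3\<^sup>r\<close>, \<open>r = |A|\<close>.
  A copy of \<open>Q\<^sub>7\<close> consists of the sets \<open>S \<union> X\<close> with \<open>X \<subseteq> I\<close>, \<open>|I| = 7\<close>, and some \<open>t \<in> {2..5}\<close> has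
  \<open>|S| + t\<close> in the residue class. If all \<open>S \<union> X\<close> with \<open>|X| = t\<close> were bases, the quotient by the span
  of \<open>S\<close> would contain an arc of 7 points in \<open>F\<^sub>3\<^sup>t\<close>, which does not exist for these \<open>t\<close>.
  Random vectors form a basis with probability at least \<open>5/9\<close>, and some residue class carries at
  most a quarter of the cube, so a hitting set of density at most \<open>4/9 \<cdot> 1/4 = 1/9\<close> exists.\<close>

section \<open>Finitely supported vectors over a finite field\<close>

definition fscale :: "'f::field \<Rightarrow> (nat \<Rightarrow> 'f) \<Rightarrow> nat \<Rightarrow> 'f" where
  "fscale c f = (\<lambda>j. c * f j)"

interpretation fv: vector_space "fscale :: 'f::field \<Rightarrow> _"
  by standard (auto simp: fscale_def fun_eq_iff algebra_simps)

text \<open>The space F^r is realised as the sequences vanishing from index \<open>r\<close> on, so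
  that all dimensions share one type. This matters because the dimension will be the size of a
  set.\<close>

definition coord_space :: "nat \<Rightarrow> (nat \<Rightarrow> 'f::field) set" where
  "coord_space r = {f. \<forall>j\<ge>r. f j = 0}"

lemma bij_betw_coord_space:
  "bij_betw (\<lambda>f. restrict f {..<r}) (coord_space r :: (nat \<Rightarrow> 'f::field) set) ({..<r} \<rightarrow>\<^sub>E UNIV)"
proof (rule bij_betw_byWitness[where f' = "\<lambda>g j. if j < r then g j else 0"])
  show "\<forall>f\<in>coord_space r. (\<lambda>j. if j < r then restrict f {..<r} j else 0) = (f :: nat \<Rightarrow> 'f)"
    by (simp add: coord_space_def fun_eq_iff)
  show "\<forall>g\<in>{..<r} \<rightarrow>\<^sub>E UNIV. restrict (\<lambda>j. if j < r then g j else (0 :: 'f)) {..<r} = g"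
  proof
    fix g :: "nat \<Rightarrow> 'f" assume "g \<in> {..<r} \<rightarrow>\<^sub>E UNIV"
    then have "restrict g {..<r} = g" by (rule PiE_restrict)
    moreover have "restrict (\<lambda>j. if j < r then g j else 0) {..<r} = restrict g {..<r}"
      by (rule restrict_ext) simp
    ultimately show "restrict (\<lambda>j. if j < r then g j else 0) {..<r} = g" by (rule trans[rotated])
  qed
  show "(\<lambda>f. restrict f {..<r}) ` coord_space r \<subseteq> {..<r} \<rightarrow>\<^sub>E (UNIV :: 'f set)"
    by (simp add: image_subset_iff restrict_PiE_iff)
  show "(\<lambda>g j. if j < r then g j else 0) ` ({..<r} \<rightarrow>\<^sub>E (UNIV :: 'f set)) \<subseteq> coord_space r"
    by (rule image_subsetI) (simp add: coord_space_def)
qed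

lemma finite_coord_space: "finite (coord_space r :: (nat \<Rightarrow> 'f::{field,finite}) set)"
  using bij_betw_finite[OF bij_betw_coord_space[where 'f='f, of r]] by (simp add: finite_PiE)

lemma card_coord_space: "card (coord_space r :: (nat \<Rightarrow> 'f::{field,finite}) set) = CARD('f) ^ r"
  using bij_betw_same_card[OF bij_betw_coord_space[where 'f='f, of r]] by (simp add: card_PiE)

lemma sum_fun_apply: "(\<Sum>i\<in>I. f i) x = (\<Sum>i\<in>I. f i x)"
  by (induction I rule: infinite_finite_induct) auto

lemma coord_space_subset_span_units:
  "coord_space r \<subseteq> fv.span ((\<lambda>i j. if j = i then 1 else 0 :: 'f::field) ` {..<r})"
proof
  fix f :: "nat \<Rightarrow> 'f" assume f: "f \<in> coord_space r"
  have eq: "(\<Sum>i<r. fscale (f i) (\<lambda>j. if j = i then 1 else 0)) = f"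
  proof
    fix j
    have "(\<Sum>i<r. fscale (f i) (\<lambda>j. if j = i then 1 else 0)) j
        = (\<Sum>i<r. if j = i then f i else 0)"
      by (simp add: fscale_def sum_fun_apply if_distrib cong: if_cong)
    also have "\<dots> = f j" using f by (auto simp: coord_space_def)
    finally show "(\<Sum>i<r. fscale (f i) (\<lambda>j. if j = i then 1 else 0)) j = f j" .
  qed
  have "(\<Sum>i<r. fscale (f i) (\<lambda>j. if j = i then 1 else 0))
      \<in> fv.span ((\<lambda>i j. if j = i then 1 else 0 :: 'f) ` {..<r})"
    by (intro fv.span_sum fv.span_scale fv.span_base) simp
  then show "f \<in> fv.span ((\<lambda>i j. if j = i then 1 else 0 :: 'f) ` {..<r})"
    unfolding eq .
qed

text \<open>A vector outside the span could be added to \<open>B\<close>, giving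
  \<open>r + 1\<close> independent vectors in the span of the \<open>r\<close> unit vectors.\<close>

lemma coord_space_subset_span:
  fixes B :: "(nat \<Rightarrow> 'f::field) set"
  assumes "fv.independent B" "B \<subseteq> coord_space r" "finite B" "card B = r"
  shows "coord_space r \<subseteq> fv.span B"
proof (rule ccontr)
  assume "\<not> ?thesis"
  then obtain x where x: "x \<in> coord_space r" "x \<notin> fv.span B" by blast
  then have "fv.independent (insert x B)" by (simp add: fv.independent_insert assms)
  moreover have "insert x B \<subseteq> fv.span ((\<lambda>i j. if j = i then 1 else 0) ` {..<r})"
    using x assms coord_space_subset_span_units[of r] by blast
  ultimately have "card (insert x B) \<le> card ((\<lambda>i j. if j = i then 1 else 0 :: 'f) ` {..<r})"
    using fv.independent_span_bound by blast
  also have "\<dots> \<le> r" using card_image_le[of "{..<r}"] by simp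
  finally have "card (insert x B) \<le> r" .
  moreover have "x \<notin> B" using x(2) fv.span_base by blast
  ultimately show False using assms by simp
qed

text \<open>Coefficient functions on \<open>B\<close> map onto the span. The bound controls the
  chance that a random vector falls into the span of earlier ones.\<close>

lemma finite_card_span:
  fixes B :: "(nat \<Rightarrow> 'f::{field,finite}) set"
  assumes "finite B"
  shows "finite (fv.span B) \<and> card (fv.span B) \<le> CARD('f) ^ card B"
proof -
  let ?s = "\<lambda>u. \<Sum>b\<in>B. fscale (u b) b"
  have "fv.span B \<subseteq> ?s ` (B \<rightarrow>\<^sub>E UNIV)"
  proof
    fix x assume "x \<in> fv.span B"
    then obtain u where "x = ?s u" using fv.span_finite[OF assms] by auto
    then have "x = ?s (restrict u B)" by simp
    then show "x \<in> ?s ` (B \<rightarrow>\<^sub>E UNIV)"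
      by (rule image_eqI[where x = "restrict u B"]) (simp add: restrict_PiE_iff)
  qed
  moreover have fin: "finite (B \<rightarrow>\<^sub>E (UNIV :: 'f set))" by (simp add: finite_PiE assms)
  moreover have "card (?s ` (B \<rightarrow>\<^sub>E (UNIV :: 'f set))) \<le> CARD('f) ^ card B"
    using card_image_le[OF fin, of ?s] by (simp add: card_PiE assms)
  ultimately show ?thesis
    using card_mono[OF finite_imageI[OF fin], of "fv.span B" ?s] finite_subset[of "fv.span B"]
    by (auto intro: le_trans)
qed

lemma in_span_Diff_of_representation_0:
  fixes B :: "(nat \<Rightarrow> 'f::field) set"
  assumes B: "fv.independent B" and y: "y \<in> fv.span B"
    and D: "\<And>b. b \<in> D \<Longrightarrow> fv.representation B y b = 0"
  shows "y \<in> fv.span (B - D)"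
proof -
  have "y = (\<Sum>b | fv.representation B y b \<noteq> 0. fscale (fv.representation B y b) b)"
    using fv.sum_nonzero_representation_eq[OF B y] by simp
  also have "\<dots> \<in> fv.span (B - D)"
    using D fv.representation_ne_zero
    by (intro fv.span_sum fv.span_scale fv.span_base) blast
  finally show ?thesis .
qed

section \<open>Independent families\<close>

text \<open>Injectivity makes a family with a repeated vector count as dependent, which the image
  set alone would not detect.\<close>

definition indep_family :: "(nat \<Rightarrow> nat \<Rightarrow> 'f::field) \<Rightarrow> nat set \<Rightarrow> bool" where
  "indep_family v A \<longleftrightarrow> inj_on v A \<and> fv.independent (v ` A)"

lemma indep_family_empty [simp]: "indep_family v {}"
  by (simp add: indep_family_def fv.independent_empty)

lemma indep_family_cong: "(\<And>i. i \<in> A \<Longrightarrow> v i = w i) \<Longrightarrow> indep_family v A \<longleftrightarrow> indep_family w A"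
  unfolding indep_family_def by (metis image_cong inj_on_cong)

lemma indep_family_insert:
  assumes "a \<notin> A"
  shows "indep_family v (insert a A) \<longleftrightarrow> indep_family v A \<and> v a \<notin> fv.span (v ` A)"
proof -
  have "v ` A - {v a} = v ` A" if "v a \<notin> v ` A" using that by blast
  then show ?thesis
    using assms fv.span_base[of "v a" "v ` A"]
    by (auto simp: indep_family_def fv.independent_insert)
qed

lemma indep_family_notin_span:
  assumes "indep_family v A" "a \<in> A"
  shows "v a \<notin> fv.span (v ` (A - {a}))"
  using assms indep_family_insert[of a "A - {a}" v] by (simp add: insert_absorb)

text \<open>Modulo the span of \<open>v ` S\<close>, of codimension \<open>t\<close>, take \<open>t\<close> of the vectors \<open>v ` T\<close> as a basis. If
  there were no dependence, all coordinates of the other vectors would be nonzero, and no two of them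
  could have proportional coordinates at two places; the pigeonhole principle excludes this.\<close>

lemma daisy_dependent:
  fixes v :: "nat \<Rightarrow> nat \<Rightarrow> 'f::{field,finite}"
  assumes v: "v ` (S \<union> T) \<subseteq> coord_space r"
    and fin: "finite S" "finite T" and disj: "S \<inter> T = {}" and r: "card S + t = r"
    and t: "2 \<le> t" "t + 2 \<le> card T" "CARD('f) \<le> t \<or> t + CARD('f) \<le> card T"
  shows "\<exists>X\<subseteq>T. card X = t \<and> \<not> indep_family v (S \<union> X)"
proof (rule ccontr)
  assume "\<not> ?thesis"
  then have ind: "indep_family v (S \<union> X)" if "X \<subseteq> T" "card X = t" for X using that by blast
  obtain X where X: "X \<subseteq> T" "card X = t" using t obtain_subset_with_card_n[of t T] by auto
  have finX: "finite X" using X fin finite_subset by blast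
  define B where "B = v ` (S \<union> X)"
  \<comment> \<open>Coordinates of \<open>v w\<close> in the basis \<open>B\<close>. They are used
    only for \<open>x\<close> in \<open>X\<close>; ignoring those along the vectors of
    \<open>S\<close> is the passage to the quotient.\<close>
  define c where "c w x = fv.representation B (v w) (v x)" for w x
  have inj: "inj_on v (S \<union> X)" and B: "fv.independent B"
    using ind[OF X] by (auto simp: indep_family_def B_def)
  have "card B = r"
    using X fin finX disj r by (auto simp: B_def card_image[OF inj] intro!: card_Un_disjoint)
  then have span: "coord_space r \<subseteq> fv.span B"
    using X fin finX v by (intro coord_space_subset_span[OF B]) (auto simp: B_def)
  have vB: "v w \<in> fv.span B" if "w \<in> T" for w using that v span by blast
  have BD: "B - v ` D = v ` (S \<union> (X - D))" if "D \<subseteq> X" for D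
  proof -
    have "B - v ` D = v ` (S \<union> X - D)"
      unfolding B_def using that inj by (subst inj_on_image_set_diff[OF inj]) auto
    also have "S \<union> X - D = S \<union> (X - D)" using that X disj by blast
    finally show ?thesis .
  qed
  \<comment> \<open>If the coordinate at \<open>x\<close> vanished, exchanging \<open>x\<close> for
    \<open>w\<close> in \<open>X\<close> would give a dependent family.\<close>
  have nz: "c w x \<noteq> 0" if w: "w \<in> T - X" and x: "x \<in> X" for w x
  proof
    assume "c w x = 0"
    then have "v w \<in> fv.span (B - v ` {x})"
      using w by (intro in_span_Diff_of_representation_0[OF B vB]) (auto simp: c_def)
    then have "v w \<in> fv.span (v ` (S \<union> (X - {x})))" using x by (subst (asm) BD) auto
    moreover have "indep_family v (S \<union> insert w (X - {x}))"
      using w x X finX t by (intro ind) auto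
    moreover have "S \<union> insert w (X - {x}) - {w} = S \<union> (X - {x})" using w disj by auto
    ultimately show False using indep_family_notin_span[of v "S \<union> insert w (X - {x})" w] by simp
  qed
  \<comment> \<open>The equation says that a 2 by 2 minor of the coordinate matrix vanishes. Then
    the combination \<open>y\<close>, chosen to cancel the coordinate at \<open>x\<close>, also
    loses the one at \<open>x'\<close>, so exchanging \<open>x\<close>, \<open>x'\<close> for
    \<open>w\<close>, \<open>w'\<close> gives a dependent family.\<close>
  have no_ratio: False
    if w: "w \<in> T - X" "w' \<in> T - X" "w \<noteq> w'" and x: "x \<in> X" "x' \<in> X" "x \<noteq> x'"
      and eq: "c w x * c w' x' = c w x' * c w' x" for w w' x x'
  proof -
    let ?Y = "X - {x, x'}"
    define y where "y = fscale (c w' x) (v w) - fscale (c w x) (v w')"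
    have sp: "fscale a (v w) \<in> fv.span B" "fscale a (v w') \<in> fv.span B" for a
      using w vB by (auto intro: fv.span_scale)
    have rep: "fv.representation B y (v z) = c w' x * c w z - c w x * c w' z" for z
      unfolding y_def c_def using w vB B sp
      by (simp add: fv.representation_diff fv.representation_scale)
    have "y \<in> fv.span (B - v ` {x, x'})"
    proof (rule in_span_Diff_of_representation_0[OF B])
      show "y \<in> fv.span B" unfolding y_def using sp by (intro fv.span_diff) auto
      show "fv.representation B y b = 0" if "b \<in> v ` {x, x'}" for b
        using that eq by (auto simp: rep mult.commute)
    qed
    then have "y \<in> fv.span (v ` (S \<union> ?Y))" using x by (subst (asm) BD) auto
    moreover have "v ` (S \<union> ?Y) \<subseteq> v ` (S \<union> insert w' ?Y)" by blast
    ultimately have "y \<in> fv.span (v ` (S \<union> insert w' ?Y))" using fv.span_mono by blast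
    moreover have "v w' \<in> fv.span (v ` (S \<union> insert w' ?Y))" by (rule fv.span_base) simp
    ultimately have "fscale (inverse (c w' x)) (y + fscale (c w x) (v w'))
        \<in> fv.span (v ` (S \<union> insert w' ?Y))"
      by (intro fv.span_scale fv.span_add)
    moreover have "fscale (inverse (c w' x)) (y + fscale (c w x) (v w')) = v w"
      using nz[OF w(2) x(1)] by (simp add: y_def)
    moreover have "indep_family v (S \<union> insert w (insert w' ?Y))"
    proof (rule ind)
      have "card ?Y = t - 2" using x X finX by (simp add: card_Diff_subset)
      then show "card (insert w (insert w' ?Y)) = t" using w finX t by simp
    qed (use w X in auto)
    moreover have "S \<union> insert w (insert w' ?Y) - {w} = S \<union> insert w' ?Y" using w disj by auto
    ultimately show False
      using indep_family_notin_span[of v "S \<union> insert w (insert w' ?Y)" w] by simp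
  qed
  have cardTX: "card (T - X) = card T - t" using X finX by (simp add: card_Diff_subset)
  have units: "card (UNIV - {0 :: 'f}) < CARD('f)" by (intro psubset_card_mono) auto
  \<comment> \<open>Write q for the field size. Quotients of coordinates take at most q - 1 values,
    all nonzero. If q \<le> \<open>t\<close>, two vectors outside \<open>X\<close> are compared at
    the \<open>t\<close> places of \<open>X\<close>; otherwise two places are compared over the at
    least q vectors of \<open>T - X\<close>. A repeated quotient contradicts
    \<open>no_ratio\<close>.\<close>
  from t(3) show False
  proof
    assume "CARD('f) \<le> t"
    obtain w w' where w: "w \<in> T - X" "w' \<in> T - X" "w \<noteq> w'"
      using card_le_Suc0_iff_eq[of "T - X"] cardTX t fin by auto
    have "(\<lambda>x. c w x / c w' x) ` X \<subseteq> UNIV - {0}" using nz w by auto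
    then have "card ((\<lambda>x. c w x / c w' x) ` X) \<le> card (UNIV - {0 :: 'f})"
      by (intro card_mono) auto
    also have "\<dots> < card X" using units \<open>CARD('f) \<le> t\<close> X(2) by linarith
    finally obtain x x' where "x \<in> X" "x' \<in> X" "x \<noteq> x'" "c w x / c w' x = c w x' / c w' x'"
      using pigeonhole[of "\<lambda>x. c w x / c w' x" X] unfolding inj_on_def by blast
    then show False using no_ratio[of w w' x x'] w nz by (simp add: frac_eq_eq)
  next
    assume "t + CARD('f) \<le> card T"
    obtain x x' where x: "x \<in> X" "x' \<in> X" "x \<noteq> x'"
      using card_le_Suc0_iff_eq[OF finX] t(1) X(2) by auto
    have "(\<lambda>w. c w x / c w x') ` (T - X) \<subseteq> UNIV - {0}" using nz x by auto
    then have "card ((\<lambda>w. c w x / c w x') ` (T - X)) \<le> card (UNIV - {0 :: 'f})"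
      by (intro card_mono) auto
    also have "\<dots> < card (T - X)" using units \<open>t + CARD('f) \<le> card T\<close> cardTX by linarith
    finally obtain w w' where "w \<in> T - X" "w' \<in> T - X" "w \<noteq> w'" "c w x / c w x' = c w' x / c w' x'"
      using pigeonhole[of "\<lambda>w. c w x / c w x'" "T - X"] unfolding inj_on_def by blast
    then show False using no_ratio[of w w' x x'] x nz by (simp add: frac_eq_eq mult.commute)
  qed
qed

section \<open>Counting independent families\<close>

text \<open>The event that the vectors at \<open>A\<close> are independent, inside the finite sample
  space of all assignments on \<open>N\<close>. For empty \<open>A\<close> it is the whole sample
  space; probabilities are expressed as ratios of cardinalities.\<close>

definition indep_maps :: "nat \<Rightarrow> nat set \<Rightarrow> nat set \<Rightarrow> (nat \<Rightarrow> nat \<Rightarrow> 'f::{field,finite}) set" where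
  "indep_maps r N A = {v \<in> N \<rightarrow>\<^sub>E coord_space r. indep_family v A}"

lemma finite_indep_maps: "finite N \<Longrightarrow> finite (indep_maps r N A)"
  unfolding indep_maps_def by (simp add: finite_PiE finite_coord_space)

text \<open>Fix the assignment off \<open>a\<close>, independent on \<open>A\<close>. Every one of
  the q^r values at \<open>a\<close> extends it to a member of \<open>W\<close>, while at most q^|A|
  of them lie in the span. This is the conditional probability bound q^(|A| - r) with denominators
  cleared.\<close>

lemma card_indep_maps_dependent_extension:
  fixes r A a N
  defines "W \<equiv> indep_maps r N A :: (nat \<Rightarrow> nat \<Rightarrow> 'f::{field,finite}) set"
  assumes N: "finite N" and A: "A \<subseteq> N" and a: "a \<in> N - A"
  shows "card {v \<in> W. v a \<in> fv.span (v ` A)} * CARD('f) ^ r \<le> card W * CARD('f) ^ card A"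
proof -
  define U :: "(nat \<Rightarrow> nat \<Rightarrow> 'f) set" where "U = indep_maps r (N - {a}) A"
  let ?f = "\<lambda>(v, x). v(a := x) :: nat \<Rightarrow> nat \<Rightarrow> 'f"
  have finA: "finite A" using N A finite_subset by blast
  have finU: "finite U" unfolding U_def by (simp add: finite_indep_maps N)
  have upd: "(v(a := x)) ` A = v ` A" for v :: "nat \<Rightarrow> nat \<Rightarrow> 'f" and x
    using a by (intro image_cong) auto
  have indep_upd: "indep_family (v(a := x)) A = indep_family v A"
    for v :: "nat \<Rightarrow> nat \<Rightarrow> 'f" and x
    using a by (intro indep_family_cong) auto
  \<comment> \<open>Maps in \<open>U\<close> take the default value at \<open>a\<close>, so
    resetting \<open>a\<close> recovers \<open>v\<close> from \<open>v(a := x)\<close>; hence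
    \<open>?f\<close> is injective.\<close>
  have U_ext: "v a = undefined" if "v \<in> U" for v
    using that by (intro PiE_arb[of v "N - {a}" "\<lambda>_. coord_space r" a])
      (simp_all add: U_def indep_maps_def)
  have inj: "inj_on ?f (U \<times> coord_space r)"
  proof (rule inj_onI, clarify)
    fix v x w y assume v: "v \<in> U" and w: "w \<in> U" and eq: "v(a := x) = w(a := y)"
    have "v = (v(a := x))(a := undefined)" by (simp flip: U_ext[OF v])
    also have "\<dots> = w" unfolding eq by (simp flip: U_ext[OF w])
    finally show "v = w \<and> x = y" using fun_cong[OF eq, of a] by simp
  qed
  have "?f ` (U \<times> coord_space r) \<subseteq> W"
  proof (clarify)
    fix v x assume "v \<in> U" "x \<in> (coord_space r :: (nat \<Rightarrow> 'f) set)"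
    then have "v(a := x) \<in> insert a (N - {a}) \<rightarrow>\<^sub>E coord_space r" "indep_family v A"
      unfolding U_def indep_maps_def by (simp_all only: mem_Collect_eq PiE_fun_upd)
    moreover have "insert a (N - {a}) = N" using a by auto
    ultimately show "v(a := x) \<in> W" by (simp add: W_def indep_maps_def indep_upd)
  qed
  then have "card (?f ` (U \<times> coord_space r)) \<le> card W"
    unfolding W_def by (intro card_mono finite_indep_maps N)
  then have W: "card U * CARD('f) ^ r \<le> card W"
    by (simp add: card_image[OF inj] card_cartesian_product card_coord_space)
  have sp: "finite (fv.span (v ` A)) \<and> card (fv.span (v ` A)) \<le> CARD('f) ^ card A"
    if "v \<in> U" for v
  proof -
    have "inj_on v A" using that by (simp add: U_def indep_maps_def indep_family_def)
    then show ?thesis using finite_card_span[of "v ` A"] finA by (simp add: card_image)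
  qed
  have finS: "finite (SIGMA v:U. fv.span (v ` A))" using finU sp by auto
  have "{v \<in> W. v a \<in> fv.span (v ` A)} \<subseteq> ?f ` (SIGMA v:U. fv.span (v ` A))"
  proof
    fix v assume "v \<in> {v \<in> W. v a \<in> fv.span (v ` A)}"
    then have v: "v \<in> N \<rightarrow>\<^sub>E coord_space r" "indep_family v A" "v a \<in> fv.span (v ` A)"
      by (simp_all add: W_def indep_maps_def)
    have "v(a := undefined) \<in> N - {a} \<rightarrow>\<^sub>E coord_space r"
    proof (rule PiE_I)
      show "(v(a := undefined)) i \<in> coord_space r" if "i \<in> N - {a}" for i
        using PiE_mem[OF v(1), of i] that by simp
      show "(v(a := undefined)) i = undefined" if "i \<notin> N - {a}" for i
        using PiE_arb[OF v(1), of i] that by auto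
    qed
    then have "(v(a := undefined), v a) \<in> (SIGMA v:U. fv.span (v ` A))"
      unfolding U_def indep_maps_def mem_Sigma_iff mem_Collect_eq indep_upd upd
      using v by (intro conjI)
    then show "v \<in> ?f ` (SIGMA v:U. fv.span (v ` A))"
      by (rule image_eqI[rotated]) simp
  qed
  then have "card {v \<in> W. v a \<in> fv.span (v ` A)} \<le> card (SIGMA v:U. fv.span (v ` A))"
    using card_mono[OF finite_imageI[OF finS]] card_image_le[OF finS] le_trans by blast
  also have "\<dots> = (\<Sum>v\<in>U. card (fv.span (v ` A)))" using finU sp by simp
  also have "\<dots> \<le> card U * CARD('f) ^ card A"
    using sum_bounded_above[of U "\<lambda>v. card (fv.span (v ` A))" "CARD('f) ^ card A"] sp by simp
  finally have "card {v \<in> W. v a \<in> fv.span (v ` A)} * CARD('f) ^ r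
      \<le> card U * CARD('f) ^ card A * CARD('f) ^ r" by (rule mult_right_mono) simp
  also have "\<dots> = card U * CARD('f) ^ r * CARD('f) ^ card A" by (simp add: ac_simps)
  also have "\<dots> \<le> card W * CARD('f) ^ card A" using W by (rule mult_right_mono) simp
  finally show ?thesis .
qed

lemma card_indep_maps_insert_ge:
  fixes r A a N
  defines "W \<equiv> \<lambda>A. indep_maps r N A :: (nat \<Rightarrow> nat \<Rightarrow> 'f::{field,finite}) set"
  assumes N: "finite N" and A: "A \<subseteq> N" and a: "a \<in> N - A"
  shows "real (card (W A)) * (1 - real (CARD('f)) ^ card A / real (CARD('f)) ^ r)
    \<le> real (card (W (insert a A)))"
proof -
  let ?D = "{v \<in> W A. v a \<in> fv.span (v ` A)}" and ?q = "real (CARD('f))"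
  have fin: "finite (W A)" unfolding W_def by (rule finite_indep_maps[OF N])
  have "a \<notin> A" using a by blast
  have "W (insert a A) = W A - ?D"
    unfolding W_def indep_maps_def indep_family_insert[OF \<open>a \<notin> A\<close>]
    by (rule Set.set_eqI, unfold mem_Collect_eq Diff_iff) argo
  then have "card (W (insert a A)) = card (W A) - card ?D"
    using fin by (simp add: card_Diff_subset)
  moreover have "card ?D \<le> card (W A)" using fin by (intro card_mono) auto
  ultimately have eq: "real (card (W (insert a A))) = real (card (W A)) - real (card ?D)" by simp
  have "real (card ?D * CARD('f) ^ r) \<le> real (card (W A) * CARD('f) ^ card A)"
    unfolding of_nat_le_iff W_def by (rule card_indep_maps_dependent_extension[OF N A a])
  then have "real (card ?D) * ?q ^ r \<le> real (card (W A)) * ?q ^ card A" by simp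
  then have "real (card ?D) \<le> real (card (W A)) * (?q ^ card A / ?q ^ r)"
    by (simp add: field_simps)
  then show ?thesis unfolding eq right_diff_distrib by linarith
qed

text \<open>Adding vectors one by one, the failure probabilities 3^(j - r) for j < |A| sum to less
  than 3^|A| / (2 * 3^r). In the induction the new term \<open>?p\<close> raises the total bound
  from \<open>?p / 2\<close> to \<open>3 * ?p / 2\<close>.\<close>

lemma card_indep_maps_ge_union_bound:
  fixes r A N
  defines "W \<equiv> \<lambda>A. indep_maps r N A :: (nat \<Rightarrow> nat \<Rightarrow> 'f::{field,finite}) set"
  assumes q: "CARD('f) = 3" and N: "finite N" and A: "A \<subseteq> N"
  shows "real (card (W {})) * (1 - 3 ^ card A / (2 * 3 ^ r)) \<le> real (card (W A))"
proof -
  have "finite A" using N A finite_subset by blast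
  then show ?thesis using A
  proof (induction A rule: finite_induct)
    case empty
    have "real (card (W {})) * (1 - 1 / (2 * 3 ^ r)) \<le> real (card (W {})) * 1"
      by (intro mult_left_mono) auto
    then show ?case by simp
  next
    case (insert a A)
    let ?T = "real (card (W {}))" and ?p = "3 ^ card A / 3 ^ r :: real"
    have "W A \<subseteq> W {}" by (simp add: W_def indep_maps_def subset_iff)
    then have le: "real (card (W A)) \<le> ?T"
      by (simp add: card_mono W_def finite_indep_maps N)
    have "?T * (1 - 3 ^ card (insert a A) / (2 * 3 ^ r)) = ?T * (1 - ?p / 2) - ?T * ?p"
      using insert.hyps by (simp add: field_simps)
    also have "\<dots> \<le> real (card (W A)) - real (card (W A)) * ?p"
    proof (rule diff_mono)
      show "?T * (1 - ?p / 2) \<le> real (card (W A))"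
        using insert.IH insert.prems by (simp add: mult.commute)
      show "real (card (W A)) * ?p \<le> ?T * ?p" by (intro mult_right_mono le) simp
    qed
    also have "\<dots> = real (card (W A)) * (1 - ?p)" by (simp only: right_diff_distrib mult_1_right)
    also have "\<dots> \<le> real (card (W (insert a A)))"
      using card_indep_maps_insert_ge[where 'f = 'f, of N A a r] insert N by (simp add: W_def q)
    finally show ?case .
  qed
qed

text \<open>The union bound for all but one vector gives 5/6, and the last vector contributes a
  factor 2/3. The union bound for all \<open>r\<close> vectors would give only 1/2, hence a hitting
  density of at most 1/8 without strict inequality.\<close>

lemma card_indep_maps_basis_ge:
  fixes r A N
  defines "W \<equiv> \<lambda>A. indep_maps r N A :: (nat \<Rightarrow> nat \<Rightarrow> 'f::{field,finite}) set"
  assumes q: "CARD('f) = 3" and N: "finite N" and A: "A \<subseteq> N" "card A = r"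
  shows "5 / 9 * real (card (W {})) \<le> real (card (W A))"
proof (cases r)
  case 0
  then have "A = {}" using A N finite_subset by fastforce
  then show ?thesis by simp
next
  case (Suc k)
  then obtain a A' where A': "A = insert a A'" "a \<notin> A'" "card A' = k"
    using A(2) card_Suc_eq[of A k] by auto
  have "real (card (W {})) * (1 - 3 ^ k / (2 * 3 ^ r)) \<le> real (card (W A'))"
    using card_indep_maps_ge_union_bound[where 'f = 'f, of N A' r] q N A A' by (simp add: W_def)
  moreover have "(1 - 3 ^ k / (2 * 3 ^ r) :: real) = 5 / 6" by (simp add: Suc)
  moreover have "real (card (W A')) * (1 - 3 ^ k / 3 ^ r) \<le> real (card (W A))"
    using card_indep_maps_insert_ge[where 'f = 'f, of N A' a r] q N A A' by (simp add: W_def)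
  moreover have "(1 - 3 ^ k / 3 ^ r :: real) = 2 / 3" by (simp add: Suc)
  ultimately show ?thesis by simp
qed

text \<open>First moment argument: the pairs of an assignment and a dependent set of size
  \<open>r\<close> are counted in both orders, and some assignment does no worse than the
  average.\<close>

lemma ex_map_few_dependent:
  assumes q: "CARD('f::{field,finite}) = 3" and N: "finite N"
  shows "\<exists>v \<in> N \<rightarrow>\<^sub>E (coord_space r :: (nat \<Rightarrow> 'f) set).
    9 * card {A. A \<subseteq> N \<and> card A = r \<and> \<not> indep_family v A} \<le> 4 * (card N choose r)"
proof (rule ccontr)
  assume neg: "\<not> ?thesis"
  define M :: "(nat \<Rightarrow> nat \<Rightarrow> 'f) set" where "M = N \<rightarrow>\<^sub>E coord_space r"
  define F where "F = {A. A \<subseteq> N \<and> card A = r}"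
  have finM: "finite M" unfolding M_def by (simp add: N finite_PiE finite_coord_space)
  have finF: "finite F" unfolding F_def using N by simp
  have cardF: "card F = card N choose r" unfolding F_def using N by (rule n_subsets)
  have "(\<lambda>_. 0) \<in> (coord_space r :: (nat \<Rightarrow> 'f) set)" by (simp add: coord_space_def)
  then have "M \<noteq> {}" unfolding M_def PiE_eq_empty_iff by blast
  have few: "card {v \<in> M. \<not> indep_family v A} \<le> 4 / 9 * real (card M)" if "A \<in> F" for A
  proof -
    have W0: "indep_maps r N {} = M" by (simp add: indep_maps_def M_def)
    have W: "indep_maps r N A = M - {v \<in> M. \<not> indep_family v A}"
      unfolding indep_maps_def M_def
      by (rule Set.set_eqI, unfold mem_Collect_eq Diff_iff) argo
    have "card {v \<in> M. \<not> indep_family v A} \<le> card M" using finM by (intro card_mono) auto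
    then have "real (card (indep_maps r N A :: (nat \<Rightarrow> nat \<Rightarrow> 'f) set))
        = real (card M) - real (card {v \<in> M. \<not> indep_family v A})"
      unfolding W by (subst card_Diff_subset) (use finM in auto)
    moreover have "5 / 9 * real (card M) \<le> real (card (indep_maps r N A :: (nat \<Rightarrow> nat \<Rightarrow> 'f) set))"
      using card_indep_maps_basis_ge[where 'f = 'f, of N A r] that q N W0 by (simp add: F_def)
    ultimately show ?thesis by simp
  qed
  have "4 / 9 * real (card F) < real (card {A \<in> F. \<not> indep_family v A})" if "v \<in> M" for v
  proof -
    have "4 * card F < 9 * card {A. A \<subseteq> N \<and> card A = r \<and> \<not> indep_family v A}"
      using neg that unfolding cardF M_def by (meson not_le)
    then have "4 * card F < 9 * card {A \<in> F. \<not> indep_family v A}"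
      by (simp add: F_def conj_assoc)
    then have "real (4 * card F) < real (9 * card {A \<in> F. \<not> indep_family v A})"
      by (simp only: of_nat_less_iff)
    then show ?thesis by simp
  qed
  then have "(\<Sum>v\<in>M. 4 / 9 * real (card F)) < (\<Sum>v\<in>M. real (card {A \<in> F. \<not> indep_family v A}))"
    using finM \<open>M \<noteq> {}\<close> by (intro sum_strict_mono)
  also have "\<dots> = (\<Sum>v\<in>M. \<Sum>A\<in>F. of_bool (\<not> indep_family v A))"
    using finF by (simp add: Int_def)
  also have "\<dots> = (\<Sum>A\<in>F. \<Sum>v\<in>M. of_bool (\<not> indep_family v A))" by (rule sum.swap)
  also have "\<dots> = (\<Sum>A\<in>F. real (card {v \<in> M. \<not> indep_family v A}))"
    using finM by (simp add: Int_def)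
  also have "\<dots> \<le> (\<Sum>A\<in>F. 4 / 9 * real (card M))" by (intro sum_mono few)
  finally show False by simp
qed

section \<open>Hitting sets for seven-dimensional subcubes\<close>

text \<open>A type of prime cardinality 3, so that \<open>three mod_ring\<close> is the field with
  three elements.\<close>

typedef three = "{..<3 :: nat}"
  by (rule exI[of _ 0]) simp

lemma CARD_three: "CARD(three) = 3"
  using type_definition.card[OF type_definition_three] by simp

instance three :: prime_card
  by standard (simp add: CARD_three)

lemma CARD_mod_ring_three: "CARD(three mod_ring) = 3"
  by (simp add: CARD_three)

lemma inj_on_cube_support: "inj_on (\<lambda>x. {i \<in> {1..n}. x i = 1}) (cube n)"
proof (rule inj_onI)
  fix x y assume x: "x \<in> cube n" and y: "y \<in> cube n"
    and eq: "{i \<in> {1..n}. x i = 1} = {i \<in> {1..n}. y i = 1}"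
  show "x = y"
  proof (rule PiE_ext[OF x[unfolded cube_def] y[unfolded cube_def]])
    fix i assume i: "i \<in> {1..n}"
    have "x i \<in> {0, 1}" using x i unfolding cube_def by (rule PiE_mem)
    moreover have "y i \<in> {0, 1}" using y i unfolding cube_def by (rule PiE_mem)
    moreover have "x i = 1 \<longleftrightarrow> y i = 1" using eq i by blast
    ultimately show "x i = y i" by auto
  qed
qed

text \<open>The four classes split the binomial sum 2^n, so one of them carries at most the average
  share.\<close>

lemma ex_sparse_residue_class:
  "\<exists>a<4. 4 * (\<Sum>r | r \<le> n \<and> r mod 4 = a. n choose r) \<le> 2 ^ n"
proof (rule ccontr)
  assume "\<not> ?thesis"
  then have "2 ^ n < 4 * (\<Sum>r | r \<le> n \<and> r mod 4 = a. n choose r)" if "a \<in> {..<4}" for a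
    using that by (simp add: not_le)
  then have "(\<Sum>a<4::nat. 2 ^ n) < (\<Sum>a<4. 4 * (\<Sum>r | r \<le> n \<and> r mod 4 = a. n choose r))"
    by (intro sum_strict_mono) (simp_all add: lessThan_empty_iff)
  also have "\<dots> = 4 * (\<Sum>a<4. \<Sum>r | r \<in> {..n} \<and> r mod 4 = a. n choose r)"
    by (simp add: sum_distrib_left)
  also have "\<dots> = 4 * (\<Sum>r\<le>n. n choose r)" by (subst sum.group) auto
  finally show False by (simp add: choose_row_sum)
qed

lemma min_hitting_7_le: "9 * min_hitting n 7 \<le> 2 ^ n"
proof -
  let ?N = "{1..n}"
  have "\<exists>v. v \<in> ?N \<rightarrow>\<^sub>E (coord_space r :: (nat \<Rightarrow> three mod_ring) set) \<and>
      9 * card {A. A \<subseteq> ?N \<and> card A = r \<and> \<not> indep_family v A} \<le> 4 * (n choose r)" for r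
    using ex_map_few_dependent[OF CARD_mod_ring_three, of ?N r] unfolding Bex_def by simp
  \<comment> \<open>Each size \<open>r\<close> gets its own assignment. This is consistent because
    every subcube will be hit within a single layer.\<close>
  then have "\<exists>v. \<forall>r. v r \<in> ?N \<rightarrow>\<^sub>E (coord_space r :: (nat \<Rightarrow> three mod_ring) set) \<and>
      9 * card {A. A \<subseteq> ?N \<and> card A = r \<and> \<not> indep_family (v r) A} \<le> 4 * (n choose r)"
    by (intro choice allI)
  then obtain v :: "nat \<Rightarrow> nat \<Rightarrow> nat \<Rightarrow> three mod_ring"
    where v_few: "\<forall>r. v r \<in> ?N \<rightarrow>\<^sub>E coord_space r \<and>
      9 * card {A. A \<subseteq> ?N \<and> card A = r \<and> \<not> indep_family (v r) A} \<le> 4 * (n choose r)" ..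
  have v: "v r \<in> ?N \<rightarrow>\<^sub>E coord_space r"
    and few: "9 * card {A. A \<subseteq> ?N \<and> card A = r \<and> \<not> indep_family (v r) A} \<le> 4 * (n choose r)" for r
    using v_few by simp_all
  obtain a where a: "a < 4" "4 * (\<Sum>r | r \<le> n \<and> r mod 4 = a. n choose r) \<le> 2 ^ n"
    using ex_sparse_residue_class by blast
  define L where "L = {r. r \<le> n \<and> r mod 4 = a}"
  define D where "D r = {A. A \<subseteq> ?N \<and> card A = r \<and> \<not> indep_family (v r) A}" for r
  define supp where "supp x = {i \<in> ?N. x i = 1}" for x :: "nat \<Rightarrow> nat"
  define R where "R = {x \<in> cube n. supp x \<in> (\<Union>r\<in>L. D r)}"
  have finL: "finite L" by (simp add: L_def)
  have finD: "finite (D r)" for r by (simp add: D_def)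
  have "inj_on supp R"
    using inj_on_cube_support unfolding supp_def by (rule inj_on_subset) (auto simp: R_def)
  then have "card R = card (supp ` R)" by (simp add: card_image)
  also have "\<dots> \<le> card (\<Union>r\<in>L. D r)" using finL finD by (intro card_mono) (auto simp: R_def)
  also have "\<dots> \<le> (\<Sum>r\<in>L. card (D r))" by (rule card_UN_le[OF finL])
  finally have "9 * card R \<le> (\<Sum>r\<in>L. 9 * card (D r))"
    by (simp flip: sum_distrib_left)
  also have "\<dots> \<le> (\<Sum>r\<in>L. 4 * (n choose r))" using few by (intro sum_mono) (simp add: D_def)
  also have "\<dots> \<le> 2 ^ n" using a(2) by (simp add: L_def flip: sum_distrib_left)
  finally have "9 * card R \<le> 2 ^ n" .
  moreover have "subcube_hitting n 7 R"
    unfolding subcube_hitting_def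
  proof (intro allI impI)
    fix Q assume "is_subcube n 7 Q"
    then obtain I b where I: "I \<subseteq> ?N" "card I = 7" and b: "b \<in> (?N - I) \<rightarrow> {0, 1}"
      and Q: "Q = {x \<in> cube n. \<forall>i \<in> ?N - I. x i = b i}"
      by (auto simp: is_subcube_def)
    \<comment> \<open>The fixed coordinates equal to 1: the supports of the points of
      \<open>Q\<close> are the sets \<open>S \<union> X\<close> with
      \<open>X \<subseteq> I\<close>.\<close>
    define S where "S = {i \<in> ?N - I. b i = 1}"
    have fin: "finite S" "finite I" using I finite_subset by (auto simp: S_def)
    \<comment> \<open>Four consecutive integers meet every class mod 4. For 7 vectors over three
      elements, \<open>daisy_dependent\<close> covers exactly these \<open>t\<close>: its last
      condition holds by the second alternative for \<open>t = 2\<close> and by the first for larger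
      \<open>t\<close>.\<close>
    have "\<exists>t. 2 \<le> t \<and> t \<le> 5 \<and> (card S + t) mod 4 = a" using a(1) by presburger
    then obtain t where t: "2 \<le> t" "t \<le> 5" "(card S + t) mod 4 = a" by blast
    let ?r = "card S + t"
    have "v ?r ` (S \<union> I) \<subseteq> coord_space ?r" 
      using I by (intro image_subsetI PiE_mem[OF v]) (auto simp: S_def)
    then have "\<exists>X\<subseteq>I. card X = t \<and> \<not> indep_family (v ?r) (S \<union> X)"
      using t fin I CARD_mod_ring_three by (intro daisy_dependent) (auto simp: S_def)
    then obtain X where X: "X \<subseteq> I" "card X = t" "\<not> indep_family (v ?r) (S \<union> X)" by blast
    have sub: "S \<union> X \<subseteq> ?N" using X I by (auto simp: S_def)
    have card: "card (S \<union> X) = ?r"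
      using X fin finite_subset[OF X(1)] by (subst card_Un_disjoint) (auto simp: S_def)
    have "?r \<le> n" using card_mono[OF _ sub] card by simp
    define x :: "nat \<Rightarrow> nat" where "x = restrict (\<lambda>i. of_bool (i \<in> S \<union> X)) ?N"
    have "x \<in> cube n" by (simp add: cube_def x_def restrict_PiE_iff)
    moreover have "supp x = S \<union> X" using sub by (auto simp: supp_def x_def)
    ultimately have "x \<in> R"
      using X card sub \<open>?r \<le> n\<close> t(3) by (auto simp: R_def L_def D_def)
    moreover have "x i = b i" if "i \<in> ?N - I" for i
    proof -
      have "b i \<in> {0, 1}" using b that by (rule Pi_mem)
      then show ?thesis using that X(1) by (auto simp: x_def S_def)
    qed
    then have "x \<in> Q" unfolding Q using \<open>x \<in> cube n\<close> by blast
    ultimately show "R \<inter> Q \<noteq> {}" by blast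
  qed
  then have "min_hitting n 7 \<le> card R" by (intro g_le_card) (auto simp: R_def)
  ultimately show ?thesis by linarith
qed

theorem theorem2:
  shows "vertex_turan_density 7 > 7 / 8 \<and> hitting_density 7 < 1 / 8"
proof -
  have "real (min_hitting n 7) / 2 ^ n \<le> 1 / 9" for n
  proof -
    have "real (9 * min_hitting n 7) \<le> real (2 ^ n)"
      unfolding of_nat_le_iff by (rule min_hitting_7_le)
    then show ?thesis by (simp add: field_simps)
  qed
  \<comment> \<open>The bound 1/9 is uniform in \<open>n\<close>, so it survives the limit and
    leaves room below 1/8.\<close>
  then have "1 - vertex_turan_density 7 \<le> 1 / 9"
    by (intro LIMSEQ_le_const2[OF LIMSEQ_g]) blast
  then show ?thesis by (simp add: hitting_density_eq)
qed

end
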